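(* Let $\alpha$ be a nonzero integer and let $(h_n)$ be the sequence with $h_0=0$, $h_1=1$, $h_2=-\alpha$, $h_3=-\alpha^3$, $h_4=0$, and for $m\ge2$: $h_{2m+1}=h_{m+2}h_m^3-h_{m-1}h_{m+1}^3$, for $m\ge 3$: $h_{2m}=h_m\big(h_{m+2}h_{m-1}^2-h_{m-2}h_{m+1}^2\big)/h_2$. (i) $h_n$ is a square for all positive integers $n$ not divisible by $4$ if and only if $\alpha$ is a square. (ii) $h_n$ is a cube for all positive integers $n$ not divisible by $4$ if and only if $\alpha$ is a cube.
   Context: The sequence defined is the elliptic divisibility sequence attached to the point $(0,0)$ of order $4$ on $y^2+xy-\alpha y=x^3-\alpha x^2$; $h_n=0$ exactly when $4\mid n$. Convention: an integer $m$ is called a square if $m=\pm\beta^2$ for some nonzero integer $\beta$, and a cube if $m=\beta^3$ for some nonzero integer $\beta$. *)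

theory Defs
  imports Complex_Main
begin

text \<open>
  Both notions exclude \<open>0\<close>, and a square is only required to be one up to sign;
  so they differ from the usual meaning of \<open>square\<close> and \<open>cube\<close> in the integers.
\<close>

definition signed_square :: "int \<Rightarrow> bool" where
  "signed_square m \<longleftrightarrow> (\<exists>\<beta>::int. \<beta> \<noteq> 0 \<and> (m = \<beta>^2 \<or> m = - (\<beta>^2)))"

definition nonzero_cube :: "int \<Rightarrow> bool" where
  "nonzero_cube m \<longleftrightarrow> (\<exists>\<beta>::int. \<beta> \<noteq> 0 \<and> m = \<beta>^3)"

end

theory Submission
  imports Defs
begin

text \<open>
  Up to sign, \<open>h n\<close> is the power of \<open>\<alpha>\<close> with exponent \<open>3 (n\<^sup>2 - 1) / 8\<close> for odd \<open>n\<close> and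
  \<open>(3 n\<^sup>2 - 4) / 8\<close> for \<open>n\<close> congruent to 2 modulo 4. So all these terms are squares (cubes) if
  \<open>\<alpha>\<close> is, and \<open>h 2 = - \<alpha>\<close> yields the converse.
\<close>

text \<open>The recurrence for index \<open>2 * m + 1\<close> involves the four consecutive indices
  \<open>m - 1\<close> to \<open>m + 2\<close>; exactly one is a multiple of 4, so a single product
  survives. For \<open>2 * m\<close> with \<open>m\<close> odd, one of \<open>m - 1\<close>,
  \<open>m + 1\<close> is a multiple of 4, with the same effect; for \<open>m\<close> even
  everything vanishes. What remains is adding exponents.\<close>

lemma eds_order4_closed_form:
  fixes a :: "'a::field" and h :: "nat \<Rightarrow> 'a"
  assumes a: "a \<noteq> 0"
    and h0: "h 0 = 0" and h1: "h 1 = 1" and h2: "h 2 = - a" and h3: "h 3 = - (a ^ 3)" and h4: "h 4 = 0"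
    and odd: "\<And>m. m \<ge> 2 \<Longrightarrow> h (2 * m + 1) = h (m + 2) * h m ^ 3 - h (m - 1) * h (m + 1) ^ 3"
    and even: "\<And>m. m \<ge> 3 \<Longrightarrow>
           h (2 * m) = h m * (h (m + 2) * h (m - 1) ^ 2 - h (m - 2) * h (m + 1) ^ 2) / h 2"
  shows "h (4 * k) = 0 \<and> h (4 * k + 1) = a ^ (6 * k * k + 3 * k) \<and>
         h (4 * k + 2) = (- 1) ^ (k + 1) * a ^ (6 * k * k + 6 * k + 1) \<and>
         h (4 * k + 3) = - (a ^ (6 * k * k + 9 * k + 3))"
proof (induction k rule: less_induct)
  case (less k)
  have h5: "h 5 = a ^ 9"
    using odd[of 2] h1 h3 h4 by (simp flip: power_mult)
  have h6: "h 6 = a ^ 13"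
    using even[of 3] a h1 h2 h3 h4 h5 by (simp add: eval_nat_numeral)
  have h7: "h 7 = - (a ^ 18)"
    using odd[of 3] h3 h4 h5 by (simp flip: power_add power_mult)
  \<comment> \<open>The four terms for \<open>k\<close> come from those for about
    \<open>k / 2\<close>: \<open>i\<close> and \<open>i + 1\<close> if \<open>k\<close> is even,
    \<open>i + 1\<close> and \<open>i + 2\<close> if it is odd. The shift keeps \<open>i + 2\<close>
    below \<open>k\<close>; for \<open>k = 1\<close> this would be circular, so that case rests on
    \<open>h4\<close> to \<open>h7\<close>.\<close>
  consider "k = 0" | "k = 1" | i where "k = 2 * (i + 1)" | i where "k = 2 * (i + 1) + 1"
  proof -
    have "k = 0 \<or> k = 1 \<or> (\<exists>i. k = 2 * (i + 1)) \<or> (\<exists>i. k = 2 * (i + 1) + 1)"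
      by presburger
    then show thesis using that by blast
  qed
  then show ?case
  proof cases
    case 1
    then show ?thesis using h0 h1 h2 h3 by (simp add: numeral_eq_Suc)
  next
    case 2
    then show ?thesis using h4 h5 h6 h7 by simp
  next
    case (3 i)
    note IH0 = less[of i] and IH1 = less[of "i + 1"]
    have m: "h (4 * i + 3) = - (a ^ (6 * i * i + 9 * i + 3))"
      "h (4 * i + 4) = 0" "h (4 * i + 5) = a ^ (6 * i * i + 15 * i + 9)"
      "h (4 * i + 6) = (- 1) ^ i * a ^ (6 * i * i + 18 * i + 13)"
      "h (4 * i + 7) = - (a ^ (6 * i * i + 21 * i + 18))"
      using IH0 IH1 3 by (simp_all add: algebra_simps)
    have "h (8 * i + 8) = 0"
      using even[of "4 * i + 4"] m by (simp add: algebra_simps)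
    moreover have "h (8 * i + 9) = a ^ (24 * i * i + 54 * i + 30)"
      using odd[of "4 * i + 4"] m by (simp add: algebra_simps flip: power_add power_mult)
    moreover have "h (8 * i + 10) = - (a ^ (24 * i * i + 60 * i + 37))"
    proof -
      \<comment> \<open>The first product dies with \<open>h (4 * i + 4) = 0\<close>, and the sign
        \<open>(- 1) ^ i\<close> of \<open>h (4 * i + 6)\<close> disappears on squaring.\<close>
      have "h (8 * i + 10) =
          a ^ (6 * i * i + 15 * i + 9) * (a ^ (6 * i * i + 9 * i + 3) *
            (a ^ (6 * i * i + 18 * i + 13)) ^ 2) / (- a)"
        using even[of "4 * i + 5"] m h2
        by (simp add: ac_simps power_mult_distrib minus_one_power_iff)
      \<comment> \<open>One factor \<open>a\<close> is split off to cancel against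
        \<open>h 2 = - a\<close>.\<close>
      also have "\<dots> = a * a ^ (24 * i * i + 60 * i + 37) / (- a)"
        by (simp add: algebra_simps flip: power_add power_mult power_Suc)
      finally show ?thesis using a by simp
    qed
    moreover have "h (8 * i + 11) = - (a ^ (24 * i * i + 66 * i + 45))"
      using odd[of "4 * i + 5"] m by (simp add: algebra_simps flip: power_add power_mult)
    ultimately show ?thesis
      using 3 by (simp add: algebra_simps)
  next
    case (4 i)
    note IH1 = less[of "i + 1"] and IH2 = less[of "i + 2"]
    have m: "h (4 * i + 4) = 0" "h (4 * i + 5) = a ^ (6 * i * i + 15 * i + 9)"
      "h (4 * i + 6) = (- 1) ^ i * a ^ (6 * i * i + 18 * i + 13)"
      "h (4 * i + 7) = - (a ^ (6 * i * i + 21 * i + 18))"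
      "h (4 * i + 8) = 0" "h (4 * i + 9) = a ^ (6 * i * i + 27 * i + 30)"
      using IH1 IH2 4 by (simp_all add: algebra_simps)
    have "h (8 * i + 12) = 0"
      using even[of "4 * i + 6"] m by (simp add: algebra_simps)
    moreover have "h (8 * i + 13) = a ^ (24 * i * i + 78 * i + 63)"
      using odd[of "4 * i + 6"] m by (simp add: algebra_simps flip: power_add power_mult)
    moreover have "h (8 * i + 14) = a ^ (24 * i * i + 84 * i + 73)"
    proof -
      \<comment> \<open>Here it is the second product that dies, through
        \<open>h (4 * i + 8) = 0\<close>.\<close>
      have "h (8 * i + 14) =
          - (a ^ (6 * i * i + 21 * i + 18) * (a ^ (6 * i * i + 27 * i + 30) *
            (a ^ (6 * i * i + 18 * i + 13)) ^ 2)) / (- a)"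
        using even[of "4 * i + 7"] m h2
        by (simp add: ac_simps power_mult_distrib minus_one_power_iff)
      also have "\<dots> = - (a * a ^ (24 * i * i + 84 * i + 73)) / (- a)"
        by (simp add: algebra_simps flip: power_add power_mult power_Suc)
      finally show ?thesis using a by simp
    qed
    moreover have "h (8 * i + 15) = - (a ^ (24 * i * i + 90 * i + 84))"
      using odd[of "4 * i + 7"] m by (simp add: algebra_simps flip: power_add power_mult)
    ultimately show ?thesis
      using 4 by (simp add: algebra_simps)
  qed
qed

text \<open>The root is \<open>b ^ e\<close>; the signs coming from \<open>x\<close> and from
  \<open>s\<close> are both absorbed by the definition.\<close>

lemma signed_square_mult_power:
  assumes "signed_square x" "s = 1 \<or> s = - 1"
  shows "signed_square (s * x ^ e)"
proof -
  obtain b where b: "b \<noteq> 0" "x = b ^ 2 \<or> x = - (b ^ 2)"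
    using assms(1) by (auto simp: signed_square_def)
  have "x ^ e = (b ^ e) ^ 2 \<or> x ^ e = - ((b ^ e) ^ 2)"
    using b(2) by (cases "even e") (auto simp: mult.commute simp flip: power_mult)
  with assms(2) b(1) show ?thesis
    unfolding signed_square_def by (intro exI[of _ "b ^ e"]) auto
qed

text \<open>Since \<open>s ^ 3 = s\<close> for a sign \<open>s\<close>, the root is
  \<open>s * b ^ e\<close>.\<close>

lemma nonzero_cube_mult_power:
  assumes "nonzero_cube x" "s = 1 \<or> s = - 1"
  shows "nonzero_cube (s * x ^ e)"
proof -
  obtain b where b: "b \<noteq> 0" "x = b ^ 3"
    using assms(1) by (auto simp: nonzero_cube_def)
  have "s * x ^ e = (s * b ^ e) ^ 3"
    using b(2) assms(2) by (auto simp: mult.commute simp flip: power_mult)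
  with assms(2) b(1) show ?thesis
    unfolding nonzero_cube_def by (intro exI[of _ "s * b ^ e"]) auto
qed

theorem theorem5p2:
  fixes \<alpha> :: int and h :: "nat \<Rightarrow> rat"
  assumes "\<alpha> \<noteq> 0"
    and "h 0 = 0" and "h 1 = 1" and "h 2 = - of_int \<alpha>" and "h 3 = - (of_int \<alpha> ^ 3)" and "h 4 = 0"
    and "\<And>m. m \<ge> 2 \<Longrightarrow> h (2 * m + 1) = h (m + 2) * h m ^ 3 - h (m - 1) * h (m + 1) ^ 3"
    and "\<And>m. m \<ge> 3 \<Longrightarrow>
           h (2 * m) = h m * (h (m + 2) * h (m - 1) ^ 2 - h (m - 2) * h (m + 1) ^ 2) / h 2"
  shows "((\<forall>n>0. \<not> 4 dvd n \<longrightarrow> (\<exists>k::int. h n = of_int k \<and> signed_square k))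
            \<longleftrightarrow> signed_square \<alpha>)
       \<and> ((\<forall>n>0. \<not> 4 dvd n \<longrightarrow> (\<exists>k::int. h n = of_int k \<and> nonzero_cube k))
            \<longleftrightarrow> nonzero_cube \<alpha>)"
proof -
  have "(of_int \<alpha> :: rat) \<noteq> 0" using assms(1) by simp
  note closed = eds_order4_closed_form[OF this assms(2-8)]
  \<comment> \<open>In particular \<open>h n\<close> is an integer in spite of the division in the
    recurrence.\<close>
  have power: "\<exists>s e. (s = 1 \<or> s = - 1) \<and> h n = of_int (s * \<alpha> ^ e)" if n: "\<not> 4 dvd n" for n
  proof -
    define k where "k = n div 4"
    have "n = 4 * k + 1 \<or> n = 4 * k + 2 \<or> n = 4 * k + 3"
      using n unfolding k_def by presburger
    then consider "n = 4 * k + 1" | "n = 4 * k + 2" | "n = 4 * k + 3"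
      by blast
    then show ?thesis
    proof cases
      case 1
      then show ?thesis using closed[of k]
        by (intro exI[of _ 1] exI[of _ "6 * k * k + 3 * k"]) simp
    next
      case 2
      then show ?thesis using closed[of k]
        by (intro exI[of _ "(- 1) ^ (k + 1)"] exI[of _ "6 * k * k + 6 * k + 1"])
          (simp add: minus_one_power_iff)
    next
      case 3
      then show ?thesis using closed[of k]
        by (intro exI[of _ "- 1"] exI[of _ "6 * k * k + 9 * k + 3"]) simp
    qed
  qed
  \<comment> \<open>Squares and cubes enter only through closure under powers and change of sign, so
    both equivalences are instances of one.\<close>
  have iff: "(\<forall>n>0. \<not> 4 dvd n \<longrightarrow> (\<exists>k::int. h n = of_int k \<and> P k)) \<longleftrightarrow> P \<alpha>"
    if P: "\<And>x s e. P x \<Longrightarrow> s = 1 \<or> s = - 1 \<Longrightarrow> P (s * x ^ e)" for P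
  proof
    assume "\<forall>n>0. \<not> 4 dvd n \<longrightarrow> (\<exists>k::int. h n = of_int k \<and> P k)"
    \<comment> \<open>At index 2 the exponent is 1, so the value differs from \<alpha> only by a
      sign, which closure with \<open>s = - 1\<close> and \<open>e = 1\<close> removes.\<close>
    from this[rule_format, of 2] obtain k :: int where k: "h 2 = of_int k" "P k"
      by auto
    have "k = - \<alpha>"
      using k(1) assms(4) by (metis of_int_eq_iff of_int_minus)
    then show "P \<alpha>"
      using P[OF k(2), of "- 1" 1] by simp
  next
    assume "P \<alpha>"
    then show "\<forall>n>0. \<not> 4 dvd n \<longrightarrow> (\<exists>k::int. h n = of_int k \<and> P k)"
      using power P by blast
  qed
  show ?thesis
    using iff[of signed_square, OF signed_square_mult_power]
      iff[of nonzero_cube, OF nonzero_cube_mult_power] by blast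
qed

end
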